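(* Let $G\colon\mathsf{Pos}\to\mathsf{Pos}$ be finitary and locally monotone and preserve embeddings and surjections, and let $\Lambda$ be a separating set of monotone predicate liftings for $G$ (equivalently, of monotone maps $[\![L]\!]\colon G\mathbbm{2}\to\mathbbm{2}$). Then the graded logic $\mathcal{L}$ for the graded monad $M_n=G^n$ (with $\alpha=\mathrm{id}_G$) having $\top$ as its only truth constant, disjunction and conjunction as propositional operators, and the modalities in $\Lambda$, is depth-0 separating and depth-1 separating, hence expressive for coalgebraic simulation: for all $G$-coalgebras $\gamma\colon X\to GX$, $\delta\colon Y\to GY$ and states $x\in X$, $y\in Y$, if $[\![\varphi]\!]_\gamma(x)\le[\![\varphi]\!]_\delta(y)$ for all formulae $\varphi$, then $\gamma_n(x)\le\delta_n(y)$ for all $n\in\omega$.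
   Context: $\mathsf{Pos}$: posets and monotone maps; $1$ the one-element poset; $\mathbbm{2}=\{\bot<\top\}$. $G$ is locally monotone if $f\le g$ pointwise implies $Gf\le Gg$; finitary if it preserves filtered colimits; embeddings are order-reflecting monotone maps. A $G$-coalgebra is a poset $X$ with monotone $\gamma\colon X\to GX$; its $n$-step behaviours are $\gamma_0=!\colon X\to1$, $\gamma_{n+1}=G\gamma_n\cdot\gamma\colon X\to G^{n+1}1$. The graded monad has $M_n=G^n$, unit and multiplications identities; $M_0$-algebras are just posets and $M_0$-morphisms monotone maps; an $M_1$-algebra is a pair of posets $A_0,A_1$ with a monotone map $a^{10}\colon GA_0\to A_1$, and a morphism $(h_0,h_1)$ satisfies $h_1\cdot a^{10}=b^{10}\cdot Gh_0$. $A$ is canonical if for every $M_1$-algebra $B$ and monotone $h\colon A_0\to B_0$ there is a unique monotone $h^\sharp\colon A_1\to B_1$ with $h^\sharp\cdot a^{10}=b^{10}\cdot Gh$. A modality $L$ is a monotone map $[\![L]\!]\colon G\mathbbm{2}\to\mathbbm{2}$ (equivalently the monotone predicate lifting sending monotone $f\colon X\to\mathbbm{2}$ to $[\![L]\!]\cdot Gf\colon GX\to\mathbbm{2}$). $\Lambda$ is separating if for all posets $X$ and $t,s\in GX$: if $[\![L]\!](Gf(t))\le[\![L]\!](Gf(s))$ for all $L\in\Lambda$ and all monotone $f\colon X\to\mathbbm{2}$, then $t\le s$. For a canonical $A$ and monotone $f\colon A_0\to\mathbbm{2}$, $[\![L]\!](f)\colon A_1\to\mathbbm{2}$ is the unique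 monotone map with $[\![L]\!](f)\cdot a^{10}=[\![L]\!]\cdot Gf$. Formulae: depth-$0$ formulae are built from $\top$ by $\wedge,\vee$; depth-$(n+1)$ formulae from $L(\psi)$ ($L\in\Lambda$, $\psi$ of depth $n$) by $\wedge,\vee$. Semantics $[\![\varphi]\!]\colon G^n1\to\mathbbm{2}$: $[\![\top]\!]$ constantly $\top$ on $G^01=1$, $\wedge,\vee$ pointwise, $[\![L(\psi)]\!]=[\![L]\!]\cdot G[\![\psi]\!]$; $[\![\varphi]\!]_\gamma=[\![\varphi]\!]\cdot\gamma_n$. A set of monotone maps is jointly order-reflecting if agreement $f(x)\le f(y)$ for all members implies $x\le y$. Depth-0 separating: the family $([\![c]\!]\colon 1\to\mathbbm{2})_{c}$ of truth constants is jointly order-reflecting. Depth-1 separating: for every canonical $M_1$-algebra $A$ and every jointly order-reflecting set $\mathfrak{A}$ of monotone maps $A_0\to\mathbbm{2}$ closed under $\wedge$ and $\vee$, the set $\{[\![L]\!](f)\mid L\in\Lambda,f\in\mathfrak{A}\}$ is jointly order-reflecting.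
   Formalization: Conjunction and disjunction include the empty cases, in formulae and in closure of the predicate sets; with binary ones only the claim fails (G X = X×{0,1}, {0,1} discrete). Posets range over subsets of an arbitrary fixed universe, which covers any finitary G up to isomorphism. *)

theory Defs
  imports Main "HOL-Library.FuncSet"
begin

section \<open>Posets and monotone maps\<close>

text \<open>
  The category of posets is rendered over a universe type \<open>'u\<close>, which is arbitrary (a free type
  variable): an object is a relation \<open>X\<close> satisfying the library predicate \<open>Partial_order\<close>, with
  carrier \<open>Field X\<close> (every element is related to itself, so no information is lost), and an arrow
  is a monotone function that is extensional on the carrier of its domain, so that equality of
  arrows with given domain and codomain is equality of functions. Identities are
  \<open>restrict id (Field X)\<close> and composites \<open>compose (Field X) g f\<close>.
\<close>

definition hom :: "'u rel \<Rightarrow> 'u rel \<Rightarrow> ('u \<Rightarrow> 'u) set" where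
  "hom X Y = {f \<in> Field X \<rightarrow>\<^sub>E Field Y. \<forall>(x, y) \<in> X. (f x, f y) \<in> Y}"

definition pointwise_le :: "'u rel \<Rightarrow> 'u rel \<Rightarrow> ('u \<Rightarrow> 'u) \<Rightarrow> ('u \<Rightarrow> 'u) \<Rightarrow> bool" where
  "pointwise_le X Y f g \<longleftrightarrow> (\<forall>x \<in> Field X. (f x, g x) \<in> Y)"

definition embedding :: "'u rel \<Rightarrow> 'u rel \<Rightarrow> ('u \<Rightarrow> 'u) \<Rightarrow> bool" where
  "embedding X Y f \<longleftrightarrow>
     f \<in> hom X Y \<and> (\<forall>x \<in> Field X. \<forall>y \<in> Field X. (f x, f y) \<in> Y \<longrightarrow> (x, y) \<in> X)"

definition surjection :: "'u rel \<Rightarrow> 'u rel \<Rightarrow> ('u \<Rightarrow> 'u) \<Rightarrow> bool" where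
  "surjection X Y f \<longleftrightarrow> f \<in> hom X Y \<and> f ` Field X = Field Y"

text \<open>
  An injection \<open>tv :: bool \<Rightarrow> 'u\<close> names the two truth values in the universe; it yields
  the posets \<open>2\<close> and \<open>1\<close> as objects over \<open>'u\<close>.
\<close>

definition Two :: "(bool \<Rightarrow> 'u) \<Rightarrow> 'u rel" where
  "Two tv = {(tv p, tv q) | p q. p \<le> q}"

definition One :: "(bool \<Rightarrow> 'u) \<Rightarrow> 'u rel" where
  "One tv = {(tv True, tv True)}"


section \<open>Endofunctors\<close>

text \<open>The action on arrows takes the domain and the codomain as arguments.\<close>

record 'u endo =
  obj :: "'u rel \<Rightarrow> 'u rel"
  arr :: "'u rel \<Rightarrow> 'u rel \<Rightarrow> ('u \<Rightarrow> 'u) \<Rightarrow> 'u \<Rightarrow> 'u"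

definition endofunctor :: "'u endo \<Rightarrow> bool" where
  "endofunctor G \<longleftrightarrow>
     (\<forall>X. Partial_order X \<longrightarrow>
        Partial_order (obj G X) \<and>
        arr G X X (restrict id (Field X)) = restrict id (Field (obj G X))) \<and>
     (\<forall>X Y. Partial_order X \<and> Partial_order Y \<longrightarrow>
        (\<forall>f \<in> hom X Y. arr G X Y f \<in> hom (obj G X) (obj G Y))) \<and>
     (\<forall>X Y Z. Partial_order X \<and> Partial_order Y \<and> Partial_order Z \<longrightarrow>
        (\<forall>f \<in> hom X Y. \<forall>g \<in> hom Y Z.
           arr G X Z (compose (Field X) g f) =
             compose (Field (obj G X)) (arr G Y Z g) (arr G X Y f)))"

definition locally_monotone :: "'u endo \<Rightarrow> bool" where
  "locally_monotone G \<longleftrightarrow>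
     (\<forall>X Y. Partial_order X \<and> Partial_order Y \<longrightarrow>
        (\<forall>f \<in> hom X Y. \<forall>g \<in> hom X Y.
           pointwise_le X Y f g \<longrightarrow>
             pointwise_le (obj G X) (obj G Y) (arr G X Y f) (arr G X Y g)))"

definition preserves_embeddings :: "'u endo \<Rightarrow> bool" where
  "preserves_embeddings G \<longleftrightarrow>
     (\<forall>X Y f. Partial_order X \<and> Partial_order Y \<and> embedding X Y f \<longrightarrow>
        embedding (obj G X) (obj G Y) (arr G X Y f))"

definition preserves_surjections :: "'u endo \<Rightarrow> bool" where
  "preserves_surjections G \<longleftrightarrow>
     (\<forall>X Y f. Partial_order X \<and> Partial_order Y \<and> surjection X Y f \<longrightarrow>
        surjection (obj G X) (obj G Y) (arr G X Y f))"


section \<open>Filtered colimits\<close>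

record ('i, 'm) cat =
  Ob :: "'i set"
  Ar :: "'m set"
  src :: "'m \<Rightarrow> 'i"
  tgt :: "'m \<Rightarrow> 'i"
  idn :: "'i \<Rightarrow> 'm"
  cmp :: "'m \<Rightarrow> 'm \<Rightarrow> 'm"

definition arrows :: "('i, 'm) cat \<Rightarrow> 'i \<Rightarrow> 'i \<Rightarrow> 'm set" where
  "arrows J i j = {u \<in> Ar J. src J u = i \<and> tgt J u = j}"

definition category :: "('i, 'm) cat \<Rightarrow> bool" where
  "category J \<longleftrightarrow>
     (\<forall>u \<in> Ar J. src J u \<in> Ob J \<and> tgt J u \<in> Ob J) \<and>
     (\<forall>i \<in> Ob J. idn J i \<in> arrows J i i) \<and>
     (\<forall>i \<in> Ob J. \<forall>j \<in> Ob J. \<forall>k \<in> Ob J. \<forall>u \<in> arrows J i j. \<forall>v \<in> arrows J j k.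
        cmp J v u \<in> arrows J i k) \<and>
     (\<forall>i \<in> Ob J. \<forall>j \<in> Ob J. \<forall>u \<in> arrows J i j.
        cmp J u (idn J i) = u \<and> cmp J (idn J j) u = u) \<and>
     (\<forall>i \<in> Ob J. \<forall>j \<in> Ob J. \<forall>k \<in> Ob J. \<forall>l \<in> Ob J.
        \<forall>u \<in> arrows J i j. \<forall>v \<in> arrows J j k. \<forall>w \<in> arrows J k l.
          cmp J w (cmp J v u) = cmp J (cmp J w v) u)"

definition filtered :: "('i, 'm) cat \<Rightarrow> bool" where
  "filtered J \<longleftrightarrow>
     category J \<and> Ob J \<noteq> {} \<and>
     (\<forall>i \<in> Ob J. \<forall>j \<in> Ob J. \<exists>k \<in> Ob J. arrows J i k \<noteq> {} \<and> arrows J j k \<noteq> {}) \<and>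
     (\<forall>i \<in> Ob J. \<forall>j \<in> Ob J. \<forall>u \<in> arrows J i j. \<forall>v \<in> arrows J i j.
        \<exists>k \<in> Ob J. \<exists>w \<in> arrows J j k. cmp J w u = cmp J w v)"

definition diagram :: "('i, 'm) cat \<Rightarrow> ('i \<Rightarrow> 'u rel) \<Rightarrow> ('m \<Rightarrow> 'u \<Rightarrow> 'u) \<Rightarrow> bool" where
  "diagram J D d \<longleftrightarrow>
     (\<forall>i \<in> Ob J. Partial_order (D i) \<and> d (idn J i) = restrict id (Field (D i))) \<and>
     (\<forall>u \<in> Ar J. d u \<in> hom (D (src J u)) (D (tgt J u))) \<and>
     (\<forall>u \<in> Ar J. \<forall>v \<in> Ar J. tgt J u = src J v \<longrightarrow>
        d (cmp J v u) = compose (Field (D (src J u))) (d v) (d u))"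

definition cocone ::
  "('i, 'm) cat \<Rightarrow> ('i \<Rightarrow> 'u rel) \<Rightarrow> ('m \<Rightarrow> 'u \<Rightarrow> 'u) \<Rightarrow> 'u rel \<Rightarrow> ('i \<Rightarrow> 'u \<Rightarrow> 'u) \<Rightarrow> bool" where
  "cocone J D d C c \<longleftrightarrow>
     Partial_order C \<and> (\<forall>i \<in> Ob J. c i \<in> hom (D i) C) \<and>
     (\<forall>u \<in> Ar J. compose (Field (D (src J u))) (c (tgt J u)) (d u) = c (src J u))"

definition colimit ::
  "('i, 'm) cat \<Rightarrow> ('i \<Rightarrow> 'u rel) \<Rightarrow> ('m \<Rightarrow> 'u \<Rightarrow> 'u) \<Rightarrow> 'u rel \<Rightarrow> ('i \<Rightarrow> 'u \<Rightarrow> 'u) \<Rightarrow> bool" where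
  "colimit J D d C c \<longleftrightarrow>
     cocone J D d C c \<and>
     (\<forall>E e. cocone J D d E e \<longrightarrow>
        (\<exists>!h. h \<in> hom C E \<and> (\<forall>i \<in> Ob J. compose (Field (D i)) h (c i) = e i)))"

text \<open>
  A formula cannot quantify over types, so the index categories have to live on fixed types; those
  below accommodate every filtered category with at most as many objects and arrows as
  \<open>'u\<close> has subsets. A colimit of posets over \<open>'u\<close> is a colimit of posets
  outright, since the maps into \<open>2\<close> jointly reflect the order; hence a functor preserving all
  small filtered colimits of posets satisfies this condition.
\<close>

definition finitary :: "'u endo \<Rightarrow> bool" where
  "finitary G \<longleftrightarrow>
     (\<forall>(J :: ('u set, 'u set \<times> 'u set) cat) D d C c.
        filtered J \<and> diagram J D d \<and> colimit J D d C c \<longrightarrow>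
          colimit J (\<lambda>i. obj G (D i)) (\<lambda>u. arr G (D (src J u)) (D (tgt J u)) (d u))
            (obj G C) (\<lambda>i. arr G (D i) C (c i)))"


section \<open>Coalgebras, and algebras for the graded monad of iterates\<close>

definition M :: "'u endo \<Rightarrow> nat \<Rightarrow> 'u rel \<Rightarrow> 'u rel" where
  "M G n = obj G ^^ n"

definition coalgebra :: "'u endo \<Rightarrow> 'u rel \<Rightarrow> ('u \<Rightarrow> 'u) \<Rightarrow> bool" where
  "coalgebra G X \<gamma> \<longleftrightarrow> Partial_order X \<and> \<gamma> \<in> hom X (obj G X)"

primrec behaviour ::
  "(bool \<Rightarrow> 'u) \<Rightarrow> 'u endo \<Rightarrow> 'u rel \<Rightarrow> ('u \<Rightarrow> 'u) \<Rightarrow> nat \<Rightarrow> 'u \<Rightarrow> 'u" where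
  "behaviour tv G X \<gamma> 0 = (\<lambda>x \<in> Field X. tv True)"
| "behaviour tv G X \<gamma> (Suc n) =
     compose (Field X) (arr G X (M G n (One tv)) (behaviour tv G X \<gamma> n)) \<gamma>"

definition M1_algebra :: "'u endo \<Rightarrow> 'u rel \<Rightarrow> 'u rel \<Rightarrow> ('u \<Rightarrow> 'u) \<Rightarrow> bool" where
  "M1_algebra G A0 A1 a \<longleftrightarrow>
     Partial_order A0 \<and> Partial_order A1 \<and> a \<in> hom (obj G A0) A1"

definition canonical :: "'u endo \<Rightarrow> 'u rel \<Rightarrow> 'u rel \<Rightarrow> ('u \<Rightarrow> 'u) \<Rightarrow> bool" where
  "canonical G A0 A1 a \<longleftrightarrow>
     M1_algebra G A0 A1 a \<and>
     (\<forall>B0 B1 b. M1_algebra G B0 B1 b \<longrightarrow>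
        (\<forall>h \<in> hom A0 B0.
           \<exists>!k. k \<in> hom A1 B1 \<and>
             compose (Field (obj G A0)) k a = compose (Field (obj G A0)) b (arr G A0 B0 h)))"


section \<open>Predicate liftings and the graded logic\<close>

text \<open>Modalities are names \<open>L :: 'l\<close>, interpreted by monotone maps \<open>I L\<close> from \<open>G 2\<close> to \<open>2\<close>.\<close>

definition modalities ::
  "(bool \<Rightarrow> 'u) \<Rightarrow> 'u endo \<Rightarrow> 'l set \<Rightarrow> ('l \<Rightarrow> 'u \<Rightarrow> 'u) \<Rightarrow> bool" where
  "modalities tv G \<Lambda> I \<longleftrightarrow> (\<forall>L \<in> \<Lambda>. I L \<in> hom (obj G (Two tv)) (Two tv))"

definition lift ::
  "(bool \<Rightarrow> 'u) \<Rightarrow> 'u endo \<Rightarrow> ('u \<Rightarrow> 'u) \<Rightarrow> 'u rel \<Rightarrow> ('u \<Rightarrow> 'u) \<Rightarrow> 'u \<Rightarrow> 'u" where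
  "lift tv G l X f = compose (Field (obj G X)) l (arr G X (Two tv) f)"

definition separating ::
  "(bool \<Rightarrow> 'u) \<Rightarrow> 'u endo \<Rightarrow> 'l set \<Rightarrow> ('l \<Rightarrow> 'u \<Rightarrow> 'u) \<Rightarrow> bool" where
  "separating tv G \<Lambda> I \<longleftrightarrow>
     (\<forall>X. Partial_order X \<longrightarrow>
        (\<forall>t \<in> Field (obj G X). \<forall>s \<in> Field (obj G X).
           (\<forall>L \<in> \<Lambda>. \<forall>f \<in> hom X (Two tv).
              (lift tv G (I L) X f t, lift tv G (I L) X f s) \<in> Two tv) \<longrightarrow>
           (t, s) \<in> obj G X))"

definition alg_lift ::
  "(bool \<Rightarrow> 'u) \<Rightarrow> 'u endo \<Rightarrow> ('u \<Rightarrow> 'u) \<Rightarrow> 'u rel \<Rightarrow> 'u rel \<Rightarrow> ('u \<Rightarrow> 'u) \<Rightarrow>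
    ('u \<Rightarrow> 'u) \<Rightarrow> 'u \<Rightarrow> 'u" where
  "alg_lift tv G l A0 A1 a f =
     (THE g. g \<in> hom A1 (Two tv) \<and> compose (Field (obj G A0)) g a = lift tv G l A0 f)"

definition jointly_order_reflecting ::
  "(bool \<Rightarrow> 'u) \<Rightarrow> 'u rel \<Rightarrow> ('u \<Rightarrow> 'u) set \<Rightarrow> bool" where
  "jointly_order_reflecting tv X F \<longleftrightarrow>
     (\<forall>x \<in> Field X. \<forall>y \<in> Field X. (\<forall>f \<in> F. (f x, f y) \<in> Two tv) \<longrightarrow> (x, y) \<in> X)"

text \<open>
  Pointwise conjunction and disjunction of a finite family of predicates on \<open>X\<close>. Conjunction and
  disjunction are understood as finitary operators, with the nullary cases included, both in
  formulae and in closure conditions. With binary operators only, the theorem fails: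
  take \<open>G X = X \<times> {0, 1}\<close> with \<open>{0, 1}\<close> discrete, and the modalities sending \<open>(p, d)\<close> to
  \<open>p\<close>, to \<open>p \<or> d = 0\<close>, and to \<open>p \<or> d = 1\<close>; these are separating, but all formulae
  generated from \<open>\<top>\<close> without the empty disjunction are constantly true.
\<close>

definition Meet :: "(bool \<Rightarrow> 'u) \<Rightarrow> 'u rel \<Rightarrow> ('u \<Rightarrow> 'u) set \<Rightarrow> 'u \<Rightarrow> 'u" where
  "Meet tv X F = (\<lambda>x \<in> Field X. tv (\<forall>f \<in> F. f x = tv True))"

definition Join :: "(bool \<Rightarrow> 'u) \<Rightarrow> 'u rel \<Rightarrow> ('u \<Rightarrow> 'u) set \<Rightarrow> 'u \<Rightarrow> 'u" where
  "Join tv X F = (\<lambda>x \<in> Field X. tv (\<exists>f \<in> F. f x = tv True))"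

definition closed_under_meet_join ::
  "(bool \<Rightarrow> 'u) \<Rightarrow> 'u rel \<Rightarrow> ('u \<Rightarrow> 'u) set \<Rightarrow> bool" where
  "closed_under_meet_join tv X \<AA> \<longleftrightarrow>
     (\<forall>F. finite F \<and> F \<subseteq> \<AA> \<longrightarrow> Meet tv X F \<in> \<AA> \<and> Join tv X F \<in> \<AA>)"

datatype 'l formula =
    Top
  | Conj "'l formula list"
  | Disj "'l formula list"
  | Modal 'l "'l formula"

text \<open>\<open>formulae \<Lambda> n \<phi>\<close> says that \<open>\<phi>\<close> is a formula of uniform depth \<open>n\<close>.\<close>

inductive formulae :: "'l set \<Rightarrow> nat \<Rightarrow> 'l formula \<Rightarrow> bool" for \<Lambda> where
  top: "formulae \<Lambda> 0 Top"
| conj: "\<forall>\<phi> \<in> set \<phi>s. formulae \<Lambda> n \<phi> \<Longrightarrow> formulae \<Lambda> n (Conj \<phi>s)"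
| disj: "\<forall>\<phi> \<in> set \<phi>s. formulae \<Lambda> n \<phi> \<Longrightarrow> formulae \<Lambda> n (Disj \<phi>s)"
| modal: "L \<in> \<Lambda> \<Longrightarrow> formulae \<Lambda> n \<psi> \<Longrightarrow> formulae \<Lambda> (Suc n) (Modal L \<psi>)"

definition truth_top :: "(bool \<Rightarrow> 'u) \<Rightarrow> 'u \<Rightarrow> 'u" where
  "truth_top tv = (\<lambda>x \<in> Field (One tv). tv True)"

text \<open>
  \<open>sem tv G I n \<phi>\<close> is the map from \<open>G\<^sup>n 1\<close> to \<open>2\<close> denoted by a formula \<open>\<phi>\<close> of depth \<open>n\<close>; the
  values in the two cases of mismatched depth are irrelevant.
\<close>

fun sem ::
  "(bool \<Rightarrow> 'u) \<Rightarrow> 'u endo \<Rightarrow> ('l \<Rightarrow> 'u \<Rightarrow> 'u) \<Rightarrow> nat \<Rightarrow> 'l formula \<Rightarrow> 'u \<Rightarrow> 'u" where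
  "sem tv G I 0 Top = truth_top tv"
| "sem tv G I (Suc n) Top = undefined"
| "sem tv G I n (Conj \<phi>s) = Meet tv (M G n (One tv)) (sem tv G I n ` set \<phi>s)"
| "sem tv G I n (Disj \<phi>s) = Join tv (M G n (One tv)) (sem tv G I n ` set \<phi>s)"
| "sem tv G I 0 (Modal L \<psi>) = undefined"
| "sem tv G I (Suc n) (Modal L \<psi>) = lift tv G (I L) (M G n (One tv)) (sem tv G I n \<psi>)"

text \<open>The only truth constant is \<open>\<top>\<close>.\<close>

definition depth0_separating :: "(bool \<Rightarrow> 'u) \<Rightarrow> bool" where
  "depth0_separating tv \<longleftrightarrow> jointly_order_reflecting tv (One tv) {truth_top tv}"

definition depth1_separating ::
  "(bool \<Rightarrow> 'u) \<Rightarrow> 'u endo \<Rightarrow> 'l set \<Rightarrow> ('l \<Rightarrow> 'u \<Rightarrow> 'u) \<Rightarrow> bool" where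
  "depth1_separating tv G \<Lambda> I \<longleftrightarrow>
     (\<forall>A0 A1 a \<AA>.
        canonical G A0 A1 a \<and> \<AA> \<subseteq> hom A0 (Two tv) \<and>
        jointly_order_reflecting tv A0 \<AA> \<and> closed_under_meet_join tv A0 \<AA> \<longrightarrow>
          jointly_order_reflecting tv A1
            {alg_lift tv G (I L) A0 A1 a f | L f. L \<in> \<Lambda> \<and> f \<in> \<AA>})"

definition formula_value ::
  "(bool \<Rightarrow> 'u) \<Rightarrow> 'u endo \<Rightarrow> ('l \<Rightarrow> 'u \<Rightarrow> 'u) \<Rightarrow> 'u rel \<Rightarrow> ('u \<Rightarrow> 'u) \<Rightarrow>
    nat \<Rightarrow> 'l formula \<Rightarrow> 'u \<Rightarrow> 'u" where
  "formula_value tv G I X \<gamma> n \<phi> = compose (Field X) (sem tv G I n \<phi>) (behaviour tv G X \<gamma> n)"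

definition expressive_for_simulation ::
  "(bool \<Rightarrow> 'u) \<Rightarrow> 'u endo \<Rightarrow> 'l set \<Rightarrow> ('l \<Rightarrow> 'u \<Rightarrow> 'u) \<Rightarrow> bool" where
  "expressive_for_simulation tv G \<Lambda> I \<longleftrightarrow>
     (\<forall>X \<gamma> Y \<delta>. coalgebra G X \<gamma> \<and> coalgebra G Y \<delta> \<longrightarrow>
        (\<forall>x \<in> Field X. \<forall>y \<in> Field Y.
           (\<forall>n \<phi>. formulae \<Lambda> n \<phi> \<longrightarrow>
              (formula_value tv G I X \<gamma> n \<phi> x, formula_value tv G I Y \<delta> n \<phi> y) \<in> Two tv) \<longrightarrow>
           (\<forall>n. (behaviour tv G X \<gamma> n x, behaviour tv G Y \<delta> n y) \<in> M G n (One tv))))"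

end

theory Submission
  imports Defs
begin

text \<open>
  A poset is the directed colimit of its finite subposets, so, since \<open>G\<close> is finitary, any two
  elements of \<open>G X\<close> come from \<open>G S\<close> for a common finite \<open>S \<subseteq> X\<close>. On a finite \<open>S\<close>, every monotone
  predicate is the restriction of a finite join of finite meets of members of a jointly
  order-reflecting family; hence to compare two elements of \<open>G X\<close> it is enough to test the
  modalities on such a family, provided that it is closed under meets and joins. Depth-1
  separation is this fact transported along the structure map of a canonical algebra, which is an
  isomorphism; expressivity is this fact iterated along \<open>1, G 1, G G 1, \<dots>\<close>.
\<close>

section \<open>Monotone maps\<close>

lemma homI:
  assumes "\<And>x. x \<in> Field X \<Longrightarrow> f x \<in> Field Y" "f \<in> extensional (Field X)"
    "\<And>x y. (x, y) \<in> X \<Longrightarrow> (f x, f y) \<in> Y"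
  shows "f \<in> hom X Y"
  using assms by (auto simp: hom_def PiE_def)

lemma hom_Field: "f \<in> hom X Y \<Longrightarrow> x \<in> Field X \<Longrightarrow> f x \<in> Field Y"
  by (auto simp: hom_def)

lemma hom_mono: "f \<in> hom X Y \<Longrightarrow> (x, y) \<in> X \<Longrightarrow> (f x, f y) \<in> Y"
  by (auto simp: hom_def)

lemma hom_extensional: "f \<in> hom X Y \<Longrightarrow> f \<in> extensional (Field X)"
  by (simp add: hom_def PiE_def)

lemma hom_eqI:
  assumes "f \<in> hom X Y" "g \<in> hom X Z" "\<And>x. x \<in> Field X \<Longrightarrow> f x = g x"
  shows "f = g"
  using assms by (meson extensionalityI hom_extensional)

lemma compose_hom: "f \<in> hom X Y \<Longrightarrow> g \<in> hom Y Z \<Longrightarrow> compose (Field X) g f \<in> hom X Z"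
  by (rule homI) (auto simp: compose_def hom_Field hom_mono FieldI1 FieldI2)

lemma restrict_id_hom: "X \<subseteq> Y \<Longrightarrow> restrict id (Field X) \<in> hom X Y"
  by (rule homI) (auto simp: FieldI1 FieldI2 mono_Field[THEN subsetD])

lemma Field_Restr: "Partial_order X \<Longrightarrow> S \<subseteq> Field X \<Longrightarrow> Field (Restr X S) = S"
  by (simp add: Refl_Field_Restr2 order_on_defs)


section \<open>Colimits\<close>

text \<open>Both \<open>h\<close> and the identity mediate from the colimit cocone to itself, so
  uniqueness identifies them.\<close>

lemma colimit_unique:
  assumes col: "colimit J D d C c" and h: "h \<in> hom C C"
    and eq: "\<And>i. i \<in> Ob J \<Longrightarrow> compose (Field (D i)) h (c i) = c i"
    and x: "x \<in> Field C"
  shows "h x = x"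
proof -
  have coc: "cocone J D d C c" using col by (simp add: colimit_def)
  have c: "c i \<in> hom (D i) C" if "i \<in> Ob J" for i
    using coc that by (simp add: cocone_def)
  have "compose (Field (D i)) (restrict id (Field C)) (c i) = c i" if "i \<in> Ob J" for i
    using c[OF that] compose_hom[OF c[OF that] restrict_id_hom[OF subset_refl]]
    by (intro hom_eqI[where X = "D i"]) (auto simp: compose_def hom_Field)
  moreover have "restrict id (Field C) \<in> hom C C" by (rule restrict_id_hom) simp
  moreover have "\<exists>!h. h \<in> hom C C \<and> (\<forall>i\<in>Ob J. compose (Field (D i)) h (c i) = c i)"
    using col coc unfolding colimit_def by blast
  ultimately have "h = restrict id (Field C)" using h eq by blast
  then show ?thesis using x by simp
qed

text \<open>The cocone factors through the union of the images of its legs, so that by the universal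
  property the inclusion of this union into the colimit has a section.\<close>

lemma colimit_jointly_surjective:
  assumes col: "colimit J D d C c" and x: "x \<in> Field C"
  shows "\<exists>i\<in>Ob J. x \<in> c i ` Field (D i)"
proof -
  have coc: "cocone J D d C c" using col by (simp add: colimit_def)
  have poC: "Partial_order C" using coc by (simp add: cocone_def)
  have c: "c i \<in> hom (D i) C" if "i \<in> Ob J" for i
    using coc that by (simp add: cocone_def)
  define S where "S = (\<Union>i\<in>Ob J. c i ` Field (D i))"
  define E where "E = Restr C S"
  have SC: "S \<subseteq> Field C" unfolding S_def using hom_Field[OF c] by blast
  have FE: "Field E = S" unfolding E_def using Field_Restr[OF poC SC] .
  have "c i \<in> hom (D i) E" if i: "i \<in> Ob J" for i
  proof -
    have cS: "c i y \<in> S" if "y \<in> Field (D i)" for y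
      using i that by (auto simp: S_def)
    show ?thesis
    proof (rule homI)
      fix y z assume yz: "(y, z) \<in> D i"
      then have "c i y \<in> S" "c i z \<in> S" by (auto simp: FieldI1 FieldI2 intro: cS)
      with hom_mono[OF c[OF i] yz] show "(c i y, c i z) \<in> E" by (simp add: E_def)
    qed (use cS hom_extensional[OF c[OF i]] in \<open>simp_all add: FE\<close>)
  qed
  then have "cocone J D d E c"
    using coc poC by (simp add: cocone_def E_def Partial_order_Restr)
  then obtain h where h: "h \<in> hom C E"
    and eq: "\<And>i. i \<in> Ob J \<Longrightarrow> compose (Field (D i)) h (c i) = c i"
    using col unfolding colimit_def by blast
  \<comment> \<open>Followed by the inclusion of \<open>E\<close> into \<open>C\<close>, the
    mediating map becomes an endomap of the colimit that fixes every leg. Being the identity, it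
    forces \<open>x\<close> into \<open>S\<close>.\<close>
  have "h \<in> hom C C"
    using h FE SC by (intro homI) (auto simp: E_def dest: hom_mono hom_Field hom_extensional)
  from colimit_unique[OF col this eq x] have "h x = x" .
  with hom_Field[OF h x] have "x \<in> S" by (simp add: FE)
  then show ?thesis by (auto simp: S_def)
qed

section \<open>Posets as directed colimits of their finite subposets\<close>

text \<open>A thin category: the only possible arrow from \<open>S\<close> to \<open>T\<close> is
  the pair \<open>(S, T)\<close>. Its objects and arrows have exactly the types over which
  \<open>finitary\<close> quantifies.\<close>

definition finite_subsets :: "'u set \<Rightarrow> ('u set, 'u set \<times> 'u set) cat" where
  "finite_subsets A =
     \<lparr>Ob = {S. finite S \<and> S \<subseteq> A}, Ar = {(S, T). finite T \<and> S \<subseteq> T \<and> T \<subseteq> A},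
      src = fst, tgt = snd, idn = (\<lambda>S. (S, S)), cmp = (\<lambda>v u. (fst u, snd v))\<rparr>"

text \<open>Unions are upper bounds, and parallel arrows coincide because a pair is determined by
  its ends, so an identity equalises them.\<close>

lemma filtered_finite_subsets: "filtered (finite_subsets A)"
  unfolding filtered_def
proof (intro conjI ballI)
  show "category (finite_subsets A)"
    unfolding category_def finite_subsets_def arrows_def by (auto intro: finite_subset)
  show "Ob (finite_subsets A) \<noteq> {}" by (auto simp: finite_subsets_def)
next
  fix S T assume "S \<in> Ob (finite_subsets A)" "T \<in> Ob (finite_subsets A)"
  then show "\<exists>k\<in>Ob (finite_subsets A).
      arrows (finite_subsets A) S k \<noteq> {} \<and> arrows (finite_subsets A) T k \<noteq> {}"
    by (intro bexI[of _ "S \<union> T"]) (auto simp: finite_subsets_def arrows_def)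
next
  fix S T u v
  assume "S \<in> Ob (finite_subsets A)" "T \<in> Ob (finite_subsets A)"
    "u \<in> arrows (finite_subsets A) S T" "v \<in> arrows (finite_subsets A) S T"
  then show "\<exists>k\<in>Ob (finite_subsets A). \<exists>w\<in>arrows (finite_subsets A) T k.
      cmp (finite_subsets A) w u = cmp (finite_subsets A) w v"
    by (intro bexI[of _ T] bexI[of _ "(T, T)"]) (auto simp: finite_subsets_def arrows_def)
qed

text \<open>Arrows act as inclusions. As an extensional function an inclusion depends only on its
  source, hence \<open>fst u\<close>.\<close>

lemma diagram_finite_subsets:
  assumes "Partial_order X"
  shows "diagram (finite_subsets (Field X)) (Restr X) (\<lambda>u. restrict id (fst u))"
proof -
  have "restrict id S \<in> hom (Restr X S) (Restr X T)" if "S \<subseteq> T" "T \<subseteq> Field X" for S T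
    using restrict_id_hom[of "Restr X S" "Restr X T"] Field_Restr[OF assms, of S] that by auto
  moreover have "partial_order_on S (Restr X S)" if "S \<subseteq> Field X" for S
    using Partial_order_Restr[OF assms, of S] by (simp add: Field_Restr[OF assms that])
  ultimately show ?thesis
    unfolding diagram_def finite_subsets_def
    by (intro conjI ballI impI) (auto
      simp: Field_Restr[OF assms] compose_def fun_eq_iff subset_iff)
qed

text \<open>Subsets with at most two elements settle the universal property: singletons fix the
  values of the mediating map, and pairs make it monotone.\<close>

lemma colimit_finite_subsets:
  assumes po: "Partial_order X"
  shows "colimit (finite_subsets (Field X)) (Restr X) (\<lambda>u. restrict id (fst u))
    X (restrict id)"
  unfolding colimit_def
proof (intro conjI allI impI)
  have "restrict id S \<in> hom (Restr X S) X" if "S \<subseteq> Field X" for S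
    using restrict_id_hom[of "Restr X S" X] Field_Restr[OF po that] by auto
  then show "cocone (finite_subsets (Field X)) (Restr X) (\<lambda>u. restrict id (fst u))
      X (restrict id)"
    by (auto simp: cocone_def finite_subsets_def po Field_Restr[OF po] compose_def
        fun_eq_iff subset_iff)
next
  fix E e
  assume coc: "cocone (finite_subsets (Field X)) (Restr X) (\<lambda>u. restrict id (fst u)) E e"
  have e: "e S \<in> hom (Restr X S) E" if "finite S" "S \<subseteq> Field X" for S
    using coc that by (simp add: cocone_def finite_subsets_def)
  have e_sub: "e S x = e T x" if "finite T" "S \<subseteq> T" "T \<subseteq> Field X" "x \<in> S" for S T x
  proof -
    have "compose (Field (Restr X S)) (e T) (restrict id S) = e S"
      using coc that(1-3) by (auto simp: cocone_def finite_subsets_def)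
    moreover have "Field (Restr X S) = S" using that by (intro Field_Restr[OF po]) auto
    ultimately show ?thesis using that(4) by (metis compose_eq id_apply restrict_apply')
  qed
  \<comment> \<open>Every index containing \<open>x\<close> receives an arrow from
    \<open>{x}\<close>, so this is the only possible value at \<open>x\<close>, and all legs defined
    at \<open>x\<close> agree with it.\<close>
  define h where "h = (\<lambda>x\<in>Field X. e {x} x)"
  have h_e: "h x = e S x" if "finite S" "S \<subseteq> Field X" "x \<in> S" for S x
    using that e_sub[of S "{x}" x] by (auto simp: h_def)
  have "h \<in> hom X E"
  proof (rule homI)
    fix x assume x: "x \<in> Field X"
    have "e {x} x \<in> Field E"
      using x Field_Restr[OF po, of "{x}"] by (intro hom_Field[OF e]) simp_all
    then show "h x \<in> Field E" using x by (simp add: h_def)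
  next
    fix x y assume xy: "(x, y) \<in> X"
    then have F: "x \<in> Field X" "y \<in> Field X" by (auto simp: FieldI1 FieldI2)
    \<comment> \<open>The subposet on \<open>{x, y}\<close> contains the given inequality, and
      \<open>h\<close> agrees with its leg there.\<close>
    have "(e {x, y} x, e {x, y} y) \<in> E"
      using xy F by (intro hom_mono[OF e]) auto
    then show "(h x, h y) \<in> E" using F h_e[of "{x, y}"] by simp
  qed (simp add: h_def)
  moreover have "compose (Field (Restr X S)) h (restrict id S) = e S"
    if "S \<in> Ob (finite_subsets (Field X))" for S
  proof (rule extensionalityI)
    show "e S \<in> extensional (Field (Restr X S))"
      using that e by (auto simp: finite_subsets_def dest: hom_extensional)
  qed (use that in \<open>auto simp: finite_subsets_def Field_Restr[OF po] compose_def h_e[of S]\<close>)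
  moreover have "k = h" if k: "k \<in> hom X E"
    and eq: "\<forall>S\<in>Ob (finite_subsets (Field X)).
      compose (Field (Restr X S)) k (restrict id S) = e S" for k
  proof (rule hom_eqI[OF k \<open>h \<in> hom X E\<close>])
    fix x assume x: "x \<in> Field X"
    then have "compose (Field (Restr X {x})) k (restrict id {x}) x = e {x} x"
      using eq by (auto simp: finite_subsets_def)
    then show "k x = h x"
      using x Field_Restr[OF po, of "{x}"] by (simp add: compose_def h_def)
  qed
  ultimately show "\<exists>!h. h \<in> hom X E \<and> (\<forall>S\<in>Ob (finite_subsets (Field X)).
      compose (Field (Restr X S)) h (restrict id S) = e S)"
    by blast
qed

section \<open>Functor laws and finite support of elements of \<open>obj G X\<close>\<close>

lemma endofunctor_obj: "endofunctor G \<Longrightarrow> Partial_order X \<Longrightarrow> Partial_order (obj G X)"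
  by (simp add: endofunctor_def)

lemma endofunctor_arr:
  "endofunctor G \<Longrightarrow> Partial_order X \<Longrightarrow> Partial_order Y \<Longrightarrow> f \<in> hom X Y \<Longrightarrow>
    arr G X Y f \<in> hom (obj G X) (obj G Y)"
  by (simp add: endofunctor_def)

lemma endofunctor_compose:
  assumes "endofunctor G" "Partial_order X" "Partial_order Y" "Partial_order Z"
    "f \<in> hom X Y" "g \<in> hom Y Z" "t \<in> Field (obj G X)"
  shows "arr G X Z (compose (Field X) g f) t = arr G Y Z g (arr G X Y f t)"
proof -
  have "arr G X Z (compose (Field X) g f) =
      compose (Field (obj G X)) (arr G Y Z g) (arr G X Y f)"
    using assms(1-6) unfolding endofunctor_def by blast
  then show ?thesis using assms(7) by (simp add: compose_def)
qed

text \<open>By finitarity \<open>obj G X\<close> is the colimit of the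
  \<open>obj G (Restr X S)\<close> over finite \<open>S\<close>, and colimit legs are jointly
  surjective. The supports of the two elements are then merged into their union.\<close>

lemma finitary_finite_support:
  assumes G: "endofunctor G" "finitary G" and po: "Partial_order X"
    and t: "t \<in> Field (obj G X)" and s: "s \<in> Field (obj G X)"
  obtains S t' s' where "finite S" "S \<subseteq> Field X"
    "t' \<in> Field (obj G (Restr X S))" "s' \<in> Field (obj G (Restr X S))"
    "t = arr G (Restr X S) X (restrict id S) t'" "s = arr G (Restr X S) X (restrict id S) s'"
proof -
  let ?J = "finite_subsets (Field X)"
  let ?c = "\<lambda>S. arr G (Restr X S) X (restrict id S)"
  let ?d = "\<lambda>S T. arr G (Restr X S) (Restr X T) (restrict id S)"
  have col: "colimit ?J (\<lambda>S. obj G (Restr X S)) (\<lambda>u. ?d (src ?J u) (tgt ?J u)) (obj G X) ?c"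
    using G(2)[unfolded finitary_def, rule_format, of ?J "Restr X"
        "\<lambda>u. restrict id (fst u)" X "restrict id"]
      filtered_finite_subsets[of "Field X"] diagram_finite_subsets[OF po]
      colimit_finite_subsets[OF po]
    by (simp add: finite_subsets_def)
  obtain S t0 where S: "S \<in> Ob ?J" and t0: "t0 \<in> Field (obj G (Restr X S))" "t = ?c S t0"
    using colimit_jointly_surjective[OF col t] by blast
  obtain T s0 where T: "T \<in> Ob ?J" and s0: "s0 \<in> Field (obj G (Restr X T))" "s = ?c T s0"
    using colimit_jointly_surjective[OF col s] by blast
  \<comment> \<open>The inclusion of \<open>U\<close> into \<open>X\<close> factors through
    \<open>S \<union> T\<close>; applying \<open>G\<close> to the factorisation moves an element
    supported on \<open>U\<close> to the union.\<close>
  have lift: "\<exists>v\<in>Field (obj G (Restr X (S \<union> T))). ?c U u = ?c (S \<union> T) v"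
    if "U \<subseteq> S \<union> T" and u: "u \<in> Field (obj G (Restr X U))" for U u
  proof -
    have sub: "U \<subseteq> Field X" "S \<union> T \<subseteq> Field X"
      using S T that(1) by (auto simp: finite_subsets_def)
    have UR: "restrict id U \<in> hom (Restr X U) (Restr X (S \<union> T))"
      using restrict_id_hom[of "Restr X U" "Restr X (S \<union> T)"] Field_Restr[OF po sub(1)] that(1)
      by auto
    have "restrict id (S \<union> T) \<in> hom (Restr X (S \<union> T)) X"
      using restrict_id_hom[of "Restr X (S \<union> T)" X] Field_Restr[OF po sub(2)] by auto
    note endofunctor_compose[OF G(1) Partial_order_Restr[OF po] Partial_order_Restr[OF po] po
        UR this u]
    moreover have "compose (Field (Restr X U)) (restrict id (S \<union> T)) (restrict id U)
        = restrict id U"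
      using that(1) by (auto simp: Field_Restr[OF po sub(1)] compose_def fun_eq_iff)
    ultimately have "?c U u = ?c (S \<union> T) (?d U (S \<union> T) u)" by simp
    moreover have "?d U (S \<union> T) u \<in> Field (obj G (Restr X (S \<union> T)))"
      using endofunctor_arr[OF G(1) Partial_order_Restr[OF po] Partial_order_Restr[OF po] UR] u
      by (rule hom_Field)
    ultimately show ?thesis by blast
  qed
  obtain t' where "t' \<in> Field (obj G (Restr X (S \<union> T)))" "t = ?c (S \<union> T) t'"
    using lift[of S t0] t0 by auto
  moreover obtain s' where "s' \<in> Field (obj G (Restr X (S \<union> T)))" "s = ?c (S \<union> T) s'"
    using lift[of T s0] s0 by auto
  moreover have "finite (S \<union> T)" "S \<union> T \<subseteq> Field X"
    using S T by (auto simp: finite_subsets_def)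
  ultimately show ?thesis using that by blast
qed


section \<open>Predicates\<close>

lemma Two_iff: "inj tv \<Longrightarrow> (tv p, tv q) \<in> Two tv \<longleftrightarrow> (p \<longrightarrow> q)"
  by (simp add: Two_def inj_eq)

lemma TwoE:
  assumes "(x, y) \<in> Two tv"
  obtains p q where "x = tv p" "y = tv q" "p \<longrightarrow> q"
  using assms that by (auto simp: Two_def le_bool_def)

lemma Field_Two: "Field (Two tv) = range tv"
proof
  show "Field (Two tv) \<subseteq> range tv" by (auto simp: Field_def elim: TwoE)
  have "(tv p, tv p) \<in> Two tv" for p unfolding Two_def by blast
  then show "range tv \<subseteq> Field (Two tv)" by (auto intro: FieldI1)
qed

lemma Field_One: "Field (One tv) = {tv True}"
  by (simp add: One_def)

lemma Partial_order_One: "Partial_order (One tv)"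
  unfolding Field_One by (simp add: One_def order_on_defs refl_on_def trans_def antisym_def)

lemma Partial_order_Two:
  assumes "inj tv"
  shows "Partial_order (Two tv)"
proof -
  have "refl_on (range tv) (Two tv)"
    using assms by (simp add: refl_on_def Two_iff)
  moreover have "trans (Two tv)"
    by (rule transI, elim TwoE) (simp add: assms Two_iff inj_eq)
  moreover have "antisym (Two tv)"
    by (rule antisymI, elim TwoE) (auto simp: assms inj_eq)
  moreover have "Two tv \<subseteq> range tv \<times> range tv" by (auto elim: TwoE)
  ultimately show ?thesis by (simp add: order_on_defs Field_Two)
qed

lemma pred_cases: "f \<in> hom X (Two tv) \<Longrightarrow> x \<in> Field X \<Longrightarrow> \<exists>p. f x = tv p"
  using hom_Field[of f X "Two tv" x] by (auto simp: Field_Two)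

lemma pred_le_iff:
  assumes "inj tv" "f \<in> hom X (Two tv)" "x \<in> Field X" "y \<in> Field X"
  shows "(f x, f y) \<in> Two tv \<longleftrightarrow> (f x = tv True \<longrightarrow> f y = tv True)"
proof -
  obtain p q where "f x = tv p" "f y = tv q" using pred_cases assms by metis
  then show ?thesis using assms(1) by (auto simp: Two_iff inj_eq)
qed

lemma Meet_hom:
  assumes "inj tv" "F \<subseteq> hom X (Two tv)"
  shows "Meet tv X F \<in> hom X (Two tv)"
proof (rule homI)
  fix x y assume xy: "(x, y) \<in> X"
  then have "x \<in> Field X" "y \<in> Field X" by (auto simp: FieldI1 FieldI2)
  then have "f x = tv True \<longrightarrow> f y = tv True" if "f \<in> F" for f
    using pred_le_iff[OF assms(1), of f X x y] hom_mono[of f X "Two tv"] xy that assms(2) by blast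
  then show "(Meet tv X F x, Meet tv X F y) \<in> Two tv"
    using \<open>x \<in> Field X\<close> \<open>y \<in> Field X\<close> assms(1) by (auto simp: Meet_def Two_iff)
qed (auto simp: Meet_def Field_Two)

lemma Join_hom:
  assumes "inj tv" "F \<subseteq> hom X (Two tv)"
  shows "Join tv X F \<in> hom X (Two tv)"
proof (rule homI)
  fix x y assume xy: "(x, y) \<in> X"
  then have "x \<in> Field X" "y \<in> Field X" by (auto simp: FieldI1 FieldI2)
  then have "f x = tv True \<longrightarrow> f y = tv True" if "f \<in> F" for f
    using pred_le_iff[OF assms(1), of f X x y] hom_mono[of f X "Two tv"] xy that assms(2) by blast
  then show "(Join tv X F x, Join tv X F y) \<in> Two tv"
    using \<open>x \<in> Field X\<close> \<open>y \<in> Field X\<close> assms(1) by (auto simp: Join_def Two_iff)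
qed (auto simp: Join_def Field_Two)

section \<open>Interpolation on finite subposets and order reflection by liftings\<close>

text \<open>Disjunctive normal form: on \<open>S\<close>, the predicate \<open>g\<close> is the
  join, over the points \<open>x\<close> where it holds, of the meets, over the points
  \<open>y\<close> where it fails, of members of \<open>\<AA>\<close> true at \<open>x\<close> and
  false at \<open>y\<close>.\<close>

lemma finite_interpolation:
  assumes tv: "inj tv" and AA: "\<AA> \<subseteq> hom X (Two tv)" and po: "Partial_order X"
    and refl: "jointly_order_reflecting tv X \<AA>" and closed: "closed_under_meet_join tv X \<AA>"
    and S: "finite S" "S \<subseteq> Field X" and g: "g \<in> hom (Restr X S) (Two tv)"
  shows "\<exists>f\<in>\<AA>. \<forall>x\<in>S. f x = g x"
proof -
  define P where "P = {x\<in>S. g x = tv True}"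
  define N where "N = {x\<in>S. g x = tv False}"
  have FS: "Field (Restr X S) = S" using S(2) by (rule Field_Restr[OF po])
  have S_PN: "x \<in> P \<or> x \<in> N" if "x \<in> S" for x
    using pred_cases[OF g, of x] that unfolding P_def N_def FS by (metis (full_types) mem_Collect_eq)
  have ne: "tv True \<noteq> tv False" using tv by (simp add: inj_eq)
  \<comment> \<open>Since \<open>g\<close> is monotone, \<open>x\<close> is not below
    \<open>y\<close>, so order reflection yields a member of \<open>\<AA>\<close> telling them
    apart.\<close>
  have "\<exists>f\<in>\<AA>. f x = tv True \<and> f y \<noteq> tv True" if "x \<in> P" "y \<in> N" for x y
  proof -
    have xy: "x \<in> S" "y \<in> S" "g x = tv True" "g y = tv False"
      using that by (auto simp: P_def N_def)
    then have "(x, y) \<notin> X"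
      using hom_mono[OF g, of x y] by (auto simp: Two_iff[OF tv])
    then obtain f where "f \<in> \<AA>" "(f x, f y) \<notin> Two tv"
      using refl xy S(2) unfolding jointly_order_reflecting_def by blast
    then show ?thesis using pred_le_iff[OF tv, of f X x y] AA xy S(2) by blast
  qed
  then obtain w where w: "\<And>x y. x \<in> P \<Longrightarrow> y \<in> N \<Longrightarrow>
      w x y \<in> \<AA> \<and> w x y x = tv True \<and> w x y y \<noteq> tv True"
    by metis
  have fin: "finite P" "finite N" using S by (auto simp: P_def N_def)
  \<comment> \<open>For \<open>x\<close> in \<open>P\<close>, this predicate holds at
    \<open>x\<close> and fails on all of \<open>N\<close>. If \<open>N\<close> is empty it is the
    empty meet, constantly true; likewise an empty \<open>P\<close> gives the empty join, constantly
    false.\<close>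
  define m where "m x = Meet tv X (w x ` N)" for x
  have "m x \<in> \<AA>" if "x \<in> P" for x
    using closed that w fin by (auto simp: closed_under_meet_join_def m_def image_subset_iff)
  then have "Join tv X (m ` P) \<in> \<AA>"
    using closed fin by (auto simp: closed_under_meet_join_def image_subset_iff)
  moreover have "Join tv X (m ` P) z = g z" if z: "z \<in> S" for z
  proof -
    have zX: "z \<in> Field X" using z S by blast
    have m_iff: "m x z = tv True \<longleftrightarrow> (\<forall>y\<in>N. w x y z = tv True)" for x
      using zX tv by (auto simp: m_def Meet_def inj_eq)
    \<comment> \<open>If \<open>z\<close> is in \<open>P\<close>, then \<open>m z\<close> is a
      witness; if \<open>z\<close> is in \<open>N\<close>, then \<open>w x z\<close> refutes each
      \<open>m x\<close>.\<close>
    have "(\<exists>x\<in>P. m x z = tv True) \<longleftrightarrow> z \<in> P"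
      unfolding m_iff using S_PN[OF z] w by blast
    then have "Join tv X (m ` P) z = tv (z \<in> P)" using zX by (simp add: Join_def)
    then show ?thesis using S_PN[OF z] ne by (auto simp: P_def N_def)
  qed
  ultimately show ?thesis by blast
qed

text \<open>Separation quantifies over all predicates, so it is applied on a common finite support
  \<open>S\<close>, where each predicate is the restriction of a member of
  \<open>\<AA>\<close>.\<close>

lemma lift_reflects_order:
  assumes tv: "inj tv" and G: "endofunctor G" "finitary G" and sep: "separating tv G \<Lambda> I"
    and po: "Partial_order X" and AA: "\<AA> \<subseteq> hom X (Two tv)"
    and refl: "jointly_order_reflecting tv X \<AA>" and closed: "closed_under_meet_join tv X \<AA>"
    and t: "t \<in> Field (obj G X)" and s: "s \<in> Field (obj G X)"
    and le: "\<And>L f. L \<in> \<Lambda> \<Longrightarrow> f \<in> \<AA> \<Longrightarrow>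
      (lift tv G (I L) X f t, lift tv G (I L) X f s) \<in> Two tv"
  shows "(t, s) \<in> obj G X"
proof -
  obtain S t' s' where S: "finite S" "S \<subseteq> Field X"
    and t': "t' \<in> Field (obj G (Restr X S))" "t = arr G (Restr X S) X (restrict id S) t'"
    and s': "s' \<in> Field (obj G (Restr X S))" "s = arr G (Restr X S) X (restrict id S) s'"
    by (rule finitary_finite_support[OF G po t s])
  have FS: "Field (Restr X S) = S" using S(2) by (rule Field_Restr[OF po])
  have poS: "Partial_order (Restr X S)" using po by (rule Partial_order_Restr)
  have inc: "restrict id S \<in> hom (Restr X S) X"
    using restrict_id_hom[of "Restr X S" X] FS by simp
  have "(lift tv G (I L) (Restr X S) g t', lift tv G (I L) (Restr X S) g s') \<in> Two tv"
    if L: "L \<in> \<Lambda>" and g: "g \<in> hom (Restr X S) (Two tv)" for L g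
  proof -
    obtain f where f: "f \<in> \<AA>" and fg: "\<forall>x\<in>S. f x = g x"
      using finite_interpolation[OF tv AA po refl closed S g] by blast
    have f_hom: "f \<in> hom X (Two tv)" using f AA by blast
    have g_eq: "compose (Field (Restr X S)) f (restrict id S) = g"
      by (rule hom_eqI[OF compose_hom[OF inc f_hom] g]) (simp add: compose_def FS fg)
    \<comment> \<open>Naturality of the lifting along the inclusion of \<open>S\<close>, with
      \<open>g\<close> the restriction of \<open>f\<close>.\<close>
    have "lift tv G (I L) (Restr X S) g u =
        lift tv G (I L) X f (arr G (Restr X S) X (restrict id S) u)"
      if u: "u \<in> Field (obj G (Restr X S))" for u
    proof -
      have "arr G (Restr X S) (Two tv) g u =
          arr G X (Two tv) f (arr G (Restr X S) X (restrict id S) u)"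
        using endofunctor_compose[OF G(1) poS po Partial_order_Two[OF tv] inc f_hom u]
        unfolding g_eq .
      then show ?thesis
        using u hom_Field[OF endofunctor_arr[OF G(1) poS po inc] u]
        by (simp only: lift_def compose_eq)
    qed
    from this[OF t'(1)] this[OF s'(1)] show ?thesis
      using le[OF L f] unfolding t'(2) s'(2) by metis
  qed
  then have "(t', s') \<in> obj G (Restr X S)"
    using sep[unfolded separating_def, rule_format, OF poS t'(1) s'(1)] by simp
  \<comment> \<open>\<open>G\<close> applied to the inclusion is monotone and carries the inequality
    into \<open>obj G X\<close>.\<close>
  then show ?thesis
    unfolding t'(2) s'(2) by (rule hom_mono[OF endofunctor_arr[OF G(1) poS po inc]])
qed


section \<open>Canonical algebras\<close>

text \<open>Taking \<open>h\<close> to be the identity in \<open>canonical\<close>, this reduces the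
  condition on \<open>k\<close> to: \<open>k\<close> after \<open>a\<close> is
  \<open>b\<close>.\<close>

lemma compose_arr_id:
  assumes "endofunctor G" "Partial_order X" "b \<in> hom (obj G X) Y"
  shows "compose (Field (obj G X)) b (arr G X X (restrict id (Field X))) = b"
proof -
  have "arr G X X (restrict id (Field X)) = restrict id (Field (obj G X))"
    using assms(1,2) by (simp add: endofunctor_def)
  then show ?thesis
    using assms(3) by (auto simp: compose_def fun_eq_iff hom_def PiE_def extensional_def)
qed

text \<open>The structure map of a canonical algebra is in fact an isomorphism; surjectivity is all that
  depth-1 separation needs beyond its monotonicity.\<close>

lemma canonical_surjective:
  assumes G: "endofunctor G" and can: "canonical G A0 A1 a" and t: "t \<in> Field A1"
  shows "t \<in> a ` Field (obj G A0)"
proof -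
  have alg: "M1_algebra G A0 A1 a" using can by (simp add: canonical_def)
  then have po: "Partial_order A0" and a: "a \<in> hom (obj G A0) A1"
    by (auto simp: M1_algebra_def)
  let ?FG = "Field (obj G A0)"
  let ?i = "restrict id (Field A0)"
  let ?u = "restrict id ?FG"
  have i: "?i \<in> hom A0 A0" by (rule restrict_id_hom) simp
  have u: "?u \<in> hom (obj G A0) (obj G A0)" by (rule restrict_id_hom) simp
  \<comment> \<open>The free algebra on \<open>A0\<close>, with the identity as structure map;
    canonicity provides \<open>k\<close> with \<open>k\<close> after \<open>a\<close> the
    identity.\<close>
  have "M1_algebra G A0 (obj G A0) ?u"
    using po u endofunctor_obj[OF G po] by (simp add: M1_algebra_def)
  then have "\<exists>!k. k \<in> hom A1 (obj G A0) \<and>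
      compose ?FG k a = compose ?FG ?u (arr G A0 A0 ?i)"
    using can i unfolding canonical_def by blast
  then obtain k where k: "k \<in> hom A1 (obj G A0)" and ka: "compose ?FG k a = ?u"
    using compose_arr_id[OF G po u] by metis
  have "\<exists>!k. k \<in> hom A1 A1 \<and> compose ?FG k a = compose ?FG a (arr G A0 A0 ?i)"
    using can alg i unfolding canonical_def by blast
  then have uniq: "h = h'" if "h \<in> hom A1 A1" "compose ?FG h a = a"
    "h' \<in> hom A1 A1" "compose ?FG h' a = a" for h h'
    using that compose_arr_id[OF G po a] by metis
  have ka': "k (a x) = x" if "x \<in> ?FG" for x
    using fun_cong[OF ka, of x] that by (simp add: compose_def)
  \<comment> \<open>Both \<open>a\<close> after \<open>k\<close> and the identity of
    \<open>A1\<close> are fixed by precomposition with \<open>a\<close>, so they agree and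
    \<open>k t\<close> is a preimage of \<open>t\<close>.\<close>
  let ?h = "compose (Field A1) a k"
  have "?h \<in> hom A1 A1" using k a by (rule compose_hom)
  moreover have "compose ?FG ?h a = a"
    by (rule hom_eqI[OF compose_hom[OF a \<open>?h \<in> hom A1 A1\<close>] a])
      (simp add: compose_def ka' hom_Field[OF a])
  moreover have id: "restrict id (Field A1) \<in> hom A1 A1" by (rule restrict_id_hom) simp
  moreover have "compose ?FG (restrict id (Field A1)) a = a"
    by (rule hom_eqI[OF compose_hom[OF a id] a]) (simp add: compose_def hom_Field[OF a])
  ultimately have "?h = restrict id (Field A1)" by (rule uniq)
  from fun_cong[OF this, of t] have "a (k t) = t" using t by (simp add: compose_def)
  then show ?thesis using hom_Field[OF k t] by (metis imageI)
qed

text \<open>The modality \<open>l\<close> is itself an algebra on \<open>Two tv\<close>, so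
  canonicity applied to \<open>f\<close> makes the definite description in \<open>alg_lift\<close>
  well defined.\<close>

lemma alg_lift_structure:
  assumes tv: "inj tv" and can: "canonical G A0 A1 a" and G: "endofunctor G"
    and l: "l \<in> hom (obj G (Two tv)) (Two tv)" and f: "f \<in> hom A0 (Two tv)"
    and t: "t \<in> Field (obj G A0)"
  shows "alg_lift tv G l A0 A1 a f (a t) = lift tv G l A0 f t"
proof -
  have "M1_algebra G (Two tv) (Two tv) l"
    using l Partial_order_Two[OF tv] by (simp add: M1_algebra_def)
  then have "\<exists>!k. k \<in> hom A1 (Two tv) \<and>
      compose (Field (obj G A0)) k a = lift tv G l A0 f"
    using can f unfolding canonical_def lift_def by blast
  from theI'[OF this]
  have "compose (Field (obj G A0)) (alg_lift tv G l A0 A1 a f) a = lift tv G l A0 f"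
    by (simp add: alg_lift_def)
  from fun_cong[OF this, of t] show ?thesis using t by (simp add: compose_def)
qed

lemma separating_imp_depth1_separating:
  assumes tv: "inj tv" and G: "endofunctor G" "finitary G"
    and mods: "modalities tv G \<Lambda> I" and sep: "separating tv G \<Lambda> I"
  shows "depth1_separating tv G \<Lambda> I"
  unfolding depth1_separating_def
proof (intro allI impI, elim conjE)
  fix A0 A1 a \<AA>
  assume can: "canonical G A0 A1 a" and AA: "\<AA> \<subseteq> hom A0 (Two tv)"
    and refl: "jointly_order_reflecting tv A0 \<AA>" and closed: "closed_under_meet_join tv A0 \<AA>"
  have po: "Partial_order A0" and a: "a \<in> hom (obj G A0) A1"
    using can by (auto simp: canonical_def M1_algebra_def)
  show "jointly_order_reflecting tv A1
      {alg_lift tv G (I L) A0 A1 a f | L f. L \<in> \<Lambda> \<and> f \<in> \<AA>}"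
    unfolding jointly_order_reflecting_def
  proof (intro ballI impI)
    fix x y assume x: "x \<in> Field A1" and y: "y \<in> Field A1"
      and le: "\<forall>g\<in>{alg_lift tv G (I L) A0 A1 a f | L f. L \<in> \<Lambda> \<and> f \<in> \<AA>}.
        (g x, g y) \<in> Two tv"
    obtain t where t: "t \<in> Field (obj G A0)" "x = a t"
      using canonical_surjective[OF G(1) can x] by (rule imageE)
    obtain s where s: "s \<in> Field (obj G A0)" "y = a s"
      using canonical_surjective[OF G(1) can y] by (rule imageE)
    \<comment> \<open>Along \<open>a\<close>, the assumption on extended predicates over
      \<open>A1\<close> becomes one on liftings over \<open>A0\<close>.\<close>
    have "(lift tv G (I L) A0 f t, lift tv G (I L) A0 f s) \<in> Two tv"
      if "L \<in> \<Lambda>" "f \<in> \<AA>" for L f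
    proof -
      have "(alg_lift tv G (I L) A0 A1 a f x, alg_lift tv G (I L) A0 A1 a f y) \<in> Two tv"
        using le that by blast
      moreover have "I L \<in> hom (obj G (Two tv)) (Two tv)"
        using mods that by (simp add: modalities_def)
      moreover have "f \<in> hom A0 (Two tv)" using AA that by blast
      ultimately show ?thesis using alg_lift_structure[OF tv can G(1)] t s by simp
    qed
    then have "(t, s) \<in> obj G A0"
      by (rule lift_reflects_order[OF tv G sep po AA refl closed t(1) s(1)])
    then show "(x, y) \<in> A1" using hom_mono[OF a] t s by simp
  qed
qed


section \<open>Formulae\<close>

lemma M_Suc: "M G (Suc n) X = obj G (M G n X)"
  by (simp add: M_def)

lemma Partial_order_M: "endofunctor G \<Longrightarrow> Partial_order X \<Longrightarrow> Partial_order (M G n X)"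
  by (induction n) (simp_all add: M_def endofunctor_obj)

lemma sem_hom:
  assumes tv: "inj tv" and G: "endofunctor G" and mods: "modalities tv G \<Lambda> I"
    and "formulae \<Lambda> n \<phi>"
  shows "sem tv G I n \<phi> \<in> hom (M G n (One tv)) (Two tv)"
  using assms(4)
proof induction
  case top
  then show ?case
    by (auto intro!: homI simp: truth_top_def M_def Field_One Field_Two One_def Two_iff[OF tv]
        extensional_def)
next
  case (conj \<phi>s n)
  then show ?case by (auto intro!: Meet_hom[OF tv])
next
  case (disj \<phi>s n)
  then show ?case by (auto intro!: Join_hom[OF tv])
next
  case (modal L n \<psi>)
  have "I L \<in> hom (obj G (Two tv)) (Two tv)" using mods modal by (simp add: modalities_def)
  with endofunctor_arr[OF G Partial_order_M[OF G Partial_order_One] Partial_order_Two[OF tv]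
      modal.IH]
  show ?case by (auto simp: lift_def M_Suc intro: compose_hom)
qed

text \<open>A finite set of denotations comes from a finite set of formulae, which can be listed as
  the arguments of one \<open>Conj\<close> or \<open>Disj\<close>; the empty list covers the nullary
  cases.\<close>

lemma closed_under_meet_join_sem:
  "closed_under_meet_join tv (M G n (One tv)) (sem tv G I n ` {\<phi>. formulae \<Lambda> n \<phi>})"
  unfolding closed_under_meet_join_def
proof (intro allI impI)
  fix F assume "finite F \<and> F \<subseteq> sem tv G I n ` {\<phi>. formulae \<Lambda> n \<phi>}"
  then obtain \<Phi> where "\<Phi> \<subseteq> {\<phi>. formulae \<Lambda> n \<phi>}" "finite \<Phi>" "F = sem tv G I n ` \<Phi>"
    by (meson finite_subset_image)
  moreover from \<open>finite \<Phi>\<close> obtain \<phi>s where "set \<phi>s = \<Phi>" using finite_list by blast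
  ultimately have "formulae \<Lambda> n (Conj \<phi>s)" "sem tv G I n (Conj \<phi>s) = Meet tv (M G n (One tv)) F"
    "formulae \<Lambda> n (Disj \<phi>s)" "sem tv G I n (Disj \<phi>s) = Join tv (M G n (One tv)) F"
    by (auto intro!: formulae.conj formulae.disj)
  then show "Meet tv (M G n (One tv)) F \<in> sem tv G I n ` {\<phi>. formulae \<Lambda> n \<phi>} \<and>
      Join tv (M G n (One tv)) F \<in> sem tv G I n ` {\<phi>. formulae \<Lambda> n \<phi>}"
    by (metis imageI mem_Collect_eq)
qed

text \<open>Induction on depth: the denotations at depth \<open>n\<close> serve as the family
  \<open>\<AA>\<close> in \<open>lift_reflects_order\<close>, and at depth \<open>Suc n\<close> the
  formulae \<open>Modal L \<psi>\<close> provide the tests required there.\<close>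

lemma sem_reflects_order:
  assumes tv: "inj tv" and G: "endofunctor G" "finitary G"
    and mods: "modalities tv G \<Lambda> I" and sep: "separating tv G \<Lambda> I"
  shows "jointly_order_reflecting tv (M G n (One tv)) (sem tv G I n ` {\<phi>. formulae \<Lambda> n \<phi>})"
proof (induction n)
  case 0
  show ?case by (simp add: jointly_order_reflecting_def M_def Field_One) (simp add: One_def)
next
  case (Suc n)
  show ?case
    unfolding jointly_order_reflecting_def M_Suc
  proof (intro ballI impI)
    fix t s
    assume t: "t \<in> Field (obj G (M G n (One tv)))" and s: "s \<in> Field (obj G (M G n (One tv)))"
      and le: "\<forall>f\<in>sem tv G I (Suc n) ` {\<phi>. formulae \<Lambda> (Suc n) \<phi>}. (f t, f s) \<in> Two tv"
    have "sem tv G I n ` {\<phi>. formulae \<Lambda> n \<phi>} \<subseteq> hom (M G n (One tv)) (Two tv)"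
      using sem_hom[OF tv G(1) mods] by auto
    then show "(t, s) \<in> obj G (M G n (One tv))"
    proof (rule lift_reflects_order[OF tv G sep Partial_order_M[OF G(1) Partial_order_One]
          _ Suc closed_under_meet_join_sem t s])
      fix L f assume L: "L \<in> \<Lambda>" and "f \<in> sem tv G I n ` {\<phi>. formulae \<Lambda> n \<phi>}"
      then obtain \<psi> where "formulae \<Lambda> n \<psi>" and f: "f = sem tv G I n \<psi>" by blast
      with L have "formulae \<Lambda> (Suc n) (Modal L \<psi>)" by (intro formulae.modal)
      with le have "(sem tv G I (Suc n) (Modal L \<psi>) t, sem tv G I (Suc n) (Modal L \<psi>) s)
          \<in> Two tv"
        by blast
      then show "(lift tv G (I L) (M G n (One tv)) f t, lift tv G (I L) (M G n (One tv)) f s)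
          \<in> Two tv"
        by (simp add: f)
    qed
  qed
qed

lemma behaviour_hom:
  assumes "endofunctor G" "coalgebra G X \<gamma>"
  shows "behaviour tv G X \<gamma> n \<in> hom X (M G n (One tv))"
proof (induction n)
  case 0
  show ?case by (rule homI) (auto simp: M_def Field_One One_def FieldI1 FieldI2 extensional_def)
next
  case (Suc n)
  have "Partial_order X" "\<gamma> \<in> hom X (obj G X)" using assms(2) by (auto simp: coalgebra_def)
  with endofunctor_arr[OF assms(1) _ Partial_order_M[OF assms(1) Partial_order_One] Suc]
  show ?case by (auto simp: M_Suc intro: compose_hom)
qed

lemma separating_imp_expressive:
  assumes tv: "inj tv" and G: "endofunctor G" "finitary G"
    and mods: "modalities tv G \<Lambda> I" and sep: "separating tv G \<Lambda> I"
  shows "expressive_for_simulation tv G \<Lambda> I"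
  unfolding expressive_for_simulation_def
proof (intro allI impI ballI, elim conjE)
  fix X \<gamma> Y \<delta> x y n
  assume coalg: "coalgebra G X \<gamma>" "coalgebra G Y \<delta>" and x: "x \<in> Field X" and y: "y \<in> Field Y"
    and le: "\<forall>n \<phi>. formulae \<Lambda> n \<phi> \<longrightarrow>
      (formula_value tv G I X \<gamma> n \<phi> x, formula_value tv G I Y \<delta> n \<phi> y) \<in> Two tv"
  have "behaviour tv G X \<gamma> n x \<in> Field (M G n (One tv))"
    "behaviour tv G Y \<delta> n y \<in> Field (M G n (One tv))"
    using hom_Field[OF behaviour_hom[OF G(1)]] coalg x y by metis+
  \<comment> \<open>The value of a formula at a state is its denotation evaluated at the behaviour
    of the state, so the assumption compares the two behaviours.\<close>
  moreover have "\<forall>f\<in>sem tv G I n ` {\<phi>. formulae \<Lambda> n \<phi>}.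
      (f (behaviour tv G X \<gamma> n x), f (behaviour tv G Y \<delta> n y)) \<in> Two tv"
    using le x y by (auto simp: formula_value_def compose_def)
  ultimately show "(behaviour tv G X \<gamma> n x, behaviour tv G Y \<delta> n y) \<in> M G n (One tv)"
    using sem_reflects_order[OF tv G mods sep, of n] unfolding jointly_order_reflecting_def
    by blast
qed

theorem mainTheorem14:
  fixes tv :: "bool \<Rightarrow> 'u"
    and G :: "'u endo"
    and \<Lambda> :: "'l set"
    and I :: "'l \<Rightarrow> 'u \<Rightarrow> 'u"
  assumes "inj tv"
    and "endofunctor G"
    and "finitary G"
    and "locally_monotone G"
    and "preserves_embeddings G"
    and "preserves_surjections G"
    and "modalities tv G \<Lambda> I"
    and "separating tv G \<Lambda> I"
  shows "depth0_separating tv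
    \<and> depth1_separating tv G \<Lambda> I
    \<and> expressive_for_simulation tv G \<Lambda> I"
proof (intro conjI)
  \<comment> \<open>The poset has a single point, so reflection amounts to reflexivity.\<close>
  show "depth0_separating tv"
    by (simp add: depth0_separating_def jointly_order_reflecting_def Field_One)
      (simp add: One_def)
  show "depth1_separating tv G \<Lambda> I"
    using assms(1-3,7,8) by (rule separating_imp_depth1_separating)
  show "expressive_for_simulation tv G \<Lambda> I"
    using assms(1-3,7,8) by (rule separating_imp_expressive)
qed

end
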